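(* Let $S$ be an integral domain, let $R$ be a subring of $S$, and let $I$ be a nonzero shared ideal of $R$ and $S$ (that is, $I \subseteq R$ is a nonzero subset that is both an ideal of $R$ and an ideal of $S$). If $S$ is Egyptian, then $R$ is Egyptian. If $S$ is generically Egyptian, then $R$ is generically Egyptian.
   Context: An element of the fraction field of an integral domain $D$ is called Egyptian (with respect to $D$) if it can be written as a finite sum $\frac{1}{d_1}+\cdots+\frac{1}{d_n}$ with $d_1,\ldots,d_n$ distinct nonzero elements of $D$. An integral domain $D$ is called Egyptian if every nonzero element of $D$ is Egyptian. An integral domain $D$ is generically Egyptian if there is some nonzero $f\in D$ such that $D[1/f]$ is Egyptian. All rings are commutative with identity, and subrings share the identity. *)

theory Defs
  imports "HOL-Algebra.Algebra"
begin

section \<open>Fields of fractions\<close>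

definition fraction :: "('a, 'b) ring_scheme \<Rightarrow> 'a \<Rightarrow> 'a \<Rightarrow> ('a \<times> 'a) set" where
  "fraction D a b =
     {(c, d). c \<in> carrier D \<and> d \<in> carrier D - {\<zero>\<^bsub>D\<^esub>} \<and> a \<otimes>\<^bsub>D\<^esub> d = c \<otimes>\<^bsub>D\<^esub> b}"

text \<open>The sum and the product are computed on all representatives of the two classes. The unions
  do not depend on the choice of representatives if \<open>D\<close> is a domain; see \<open>fraction_add\<close> and
  \<open>fraction_mult\<close>.\<close>

definition fraction_field :: "('a, 'b) ring_scheme \<Rightarrow> ('a \<times> 'a) set ring" where
  "fraction_field D =
     \<lparr>carrier = {fraction D a b | a b. a \<in> carrier D \<and> b \<in> carrier D - {\<zero>\<^bsub>D\<^esub>}},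
      monoid.mult = (\<lambda>p q. \<Union>(a, b) \<in> p. \<Union>(c, d) \<in> q. fraction D (a \<otimes>\<^bsub>D\<^esub> c) (b \<otimes>\<^bsub>D\<^esub> d)),
      monoid.one = fraction D \<one>\<^bsub>D\<^esub> \<one>\<^bsub>D\<^esub>,
      ring.zero = fraction D \<zero>\<^bsub>D\<^esub> \<one>\<^bsub>D\<^esub>,
      ring.add = (\<lambda>p q. \<Union>(a, b) \<in> p. \<Union>(c, d) \<in> q.
        fraction D ((a \<otimes>\<^bsub>D\<^esub> d) \<oplus>\<^bsub>D\<^esub> (c \<otimes>\<^bsub>D\<^esub> b)) (b \<otimes>\<^bsub>D\<^esub> d))\<rparr>"

abbreviation to_fraction :: "('a, 'b) ring_scheme \<Rightarrow> 'a \<Rightarrow> ('a \<times> 'a) set" where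
  "to_fraction D a \<equiv> fraction D a \<one>\<^bsub>D\<^esub>"

context domain
begin

lemma fraction_eq_iff:
  assumes "a \<in> carrier R" "b \<in> carrier R - {\<zero>}" "c \<in> carrier R" "d \<in> carrier R - {\<zero>}"
  shows "fraction R a b = fraction R c d \<longleftrightarrow> a \<otimes> d = c \<otimes> b"
proof
  assume "fraction R a b = fraction R c d"
  moreover have "(c, d) \<in> fraction R c d"
    using assms by (auto simp: fraction_def)
  ultimately show "a \<otimes> d = c \<otimes> b"
    by (auto simp: fraction_def)
next
  assume eq: "a \<otimes> d = c \<otimes> b"
  have "a \<otimes> y = x \<otimes> b \<longleftrightarrow> c \<otimes> y = x \<otimes> d" if "x \<in> carrier R" "y \<in> carrier R" for x y
  proof -
    have "a \<otimes> y = x \<otimes> b \<longleftrightarrow> (a \<otimes> y) \<otimes> d = (x \<otimes> b) \<otimes> d"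
      using assms that by (simp add: m_rcancel)
    also have "(a \<otimes> y) \<otimes> d = (c \<otimes> y) \<otimes> b"
    proof -
      have "(a \<otimes> y) \<otimes> d = (a \<otimes> d) \<otimes> y" using assms that by (simp add: m_ac)
      also have "\<dots> = (c \<otimes> y) \<otimes> b" using assms that by (simp add: eq m_ac)
      finally show ?thesis .
    qed
    also have "(x \<otimes> b) \<otimes> d = (x \<otimes> d) \<otimes> b" using assms that by (simp add: m_ac)
    also have "(c \<otimes> y) \<otimes> b = (x \<otimes> d) \<otimes> b \<longleftrightarrow> c \<otimes> y = x \<otimes> d"
      using assms that by (simp add: m_rcancel)
    finally show ?thesis .
  qed
  then show "fraction R a b = fraction R c d"
    by (auto simp: fraction_def)
qed

lemma fraction_self:
  assumes "a \<in> carrier R" "b \<in> carrier R - {\<zero>}"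
  shows "(a, b) \<in> fraction R a b"
  using assms by (auto simp: fraction_def)

lemma UN_pairs_const:
  assumes "p \<in> A" "q \<in> B"
    and const: "\<And>x y z w. (x, y) \<in> A \<Longrightarrow> (z, w) \<in> B \<Longrightarrow> f x y z w = C"
  shows "(\<Union>(x, y) \<in> A. \<Union>(z, w) \<in> B. f x y z w) = C"
proof -
  have "(\<Union>(x, y) \<in> A. \<Union>(z, w) \<in> B. f x y z w) = (\<Union>_ \<in> A. \<Union>_ \<in> B. C)"
    by (intro SUP_cong refl) (auto simp only: const split: prod.split)
  then show ?thesis
    using assms(1,2) by auto
qed

lemma fraction_mult:
  assumes "a \<in> carrier R" "b \<in> carrier R - {\<zero>}" "c \<in> carrier R" "d \<in> carrier R - {\<zero>}"
  shows "fraction R a b \<otimes>\<^bsub>fraction_field R\<^esub> fraction R c d = fraction R (a \<otimes> c) (b \<otimes> d)"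
    (is "_ = ?rhs")
proof -
  have "fraction R (x \<otimes> z) (y \<otimes> w) = fraction R (a \<otimes> c) (b \<otimes> d)"
    if "(x, y) \<in> fraction R a b" "(z, w) \<in> fraction R c d" for x y z w
  proof -
    have xyzw: "x \<in> carrier R" "y \<in> carrier R - {\<zero>}" "z \<in> carrier R" "w \<in> carrier R - {\<zero>}"
      and eq: "a \<otimes> y = x \<otimes> b" "c \<otimes> w = z \<otimes> d"
      using that by (auto simp: fraction_def)
    have "(x \<otimes> z) \<otimes> (b \<otimes> d) = (x \<otimes> b) \<otimes> (z \<otimes> d)" using xyzw assms by (simp add: m_ac)
    also have "\<dots> = (a \<otimes> y) \<otimes> (c \<otimes> w)" by (simp add: eq)
    also have "\<dots> = (a \<otimes> c) \<otimes> (y \<otimes> w)" using xyzw assms by (simp add: m_ac)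
    finally show ?thesis
      using xyzw assms by (subst fraction_eq_iff) (auto simp: integral_iff)
  qed
  note const = this
  have "fraction R a b \<otimes>\<^bsub>fraction_field R\<^esub> fraction R c d
      = (\<Union>(x, y) \<in> fraction R a b. \<Union>(z, w) \<in> fraction R c d. fraction R (x \<otimes> z) (y \<otimes> w))"
    by (simp only: fraction_field_def monoid.select_convs ring.select_convs)
  also have "\<dots> = ?rhs"
    by (rule UN_pairs_const[OF fraction_self[OF assms(1,2)] fraction_self[OF assms(3,4)] const])
  finally show ?thesis .
qed

lemma fraction_add:
  assumes "a \<in> carrier R" "b \<in> carrier R - {\<zero>}" "c \<in> carrier R" "d \<in> carrier R - {\<zero>}"
  shows "fraction R a b \<oplus>\<^bsub>fraction_field R\<^esub> fraction R c d
    = fraction R ((a \<otimes> d) \<oplus> (c \<otimes> b)) (b \<otimes> d)"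
    (is "_ = ?rhs")
proof -
  have "fraction R ((x \<otimes> w) \<oplus> (z \<otimes> y)) (y \<otimes> w) = fraction R ((a \<otimes> d) \<oplus> (c \<otimes> b)) (b \<otimes> d)"
    if "(x, y) \<in> fraction R a b" "(z, w) \<in> fraction R c d" for x y z w
  proof -
    have xyzw: "x \<in> carrier R" "y \<in> carrier R - {\<zero>}" "z \<in> carrier R" "w \<in> carrier R - {\<zero>}"
      and eq: "a \<otimes> y = x \<otimes> b" "c \<otimes> w = z \<otimes> d"
      using that by (auto simp: fraction_def)
    have cl: "x \<in> carrier R" "y \<in> carrier R" "z \<in> carrier R" "w \<in> carrier R"
      "a \<in> carrier R" "b \<in> carrier R" "c \<in> carrier R" "d \<in> carrier R"
      using xyzw assms by auto
    have "((x \<otimes> w) \<oplus> (z \<otimes> y)) \<otimes> (b \<otimes> d)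
        = ((x \<otimes> b) \<otimes> (w \<otimes> d)) \<oplus> ((z \<otimes> d) \<otimes> (y \<otimes> b))"
      using cl by algebra
    also have "\<dots> = ((a \<otimes> y) \<otimes> (w \<otimes> d)) \<oplus> ((c \<otimes> w) \<otimes> (y \<otimes> b))"
      by (simp only: eq)
    also have "\<dots> = ((a \<otimes> d) \<oplus> (c \<otimes> b)) \<otimes> (y \<otimes> w)"
      using cl by algebra
    finally have "((x \<otimes> w) \<oplus> (z \<otimes> y)) \<otimes> (b \<otimes> d) = ((a \<otimes> d) \<oplus> (c \<otimes> b)) \<otimes> (y \<otimes> w)" .
    moreover have "y \<otimes> w \<in> carrier R - {\<zero>}" "b \<otimes> d \<in> carrier R - {\<zero>}"
      using xyzw assms by (auto simp: integral_iff)
    ultimately show ?thesis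
      using cl by (subst fraction_eq_iff) simp_all
  qed
  note const = this
  have "fraction R a b \<oplus>\<^bsub>fraction_field R\<^esub> fraction R c d
      = (\<Union>(x, y) \<in> fraction R a b. \<Union>(z, w) \<in> fraction R c d. fraction R ((x \<otimes> w) \<oplus> (z \<otimes> y)) (y \<otimes> w))"
    by (simp only: fraction_field_def monoid.select_convs ring.select_convs)
  also have "\<dots> = ?rhs"
    by (rule UN_pairs_const[OF fraction_self[OF assms(1,2)] fraction_self[OF assms(3,4)] const])
  finally show ?thesis .
qed

lemma fraction_in_carrier:
  assumes "a \<in> carrier R" "b \<in> carrier R - {\<zero>}"
  shows "fraction R a b \<in> carrier (fraction_field R)"
  using assms by (auto simp: fraction_field_def)

lemma fraction_carrierE:
  assumes "x \<in> carrier (fraction_field R)"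
  obtains a b where "a \<in> carrier R" "b \<in> carrier R" "b \<noteq> \<zero>" "x = fraction R a b"
  using assms by (auto simp: fraction_field_def)

lemma fraction_zero: "\<zero>\<^bsub>fraction_field R\<^esub> = fraction R \<zero> \<one>"
  and fraction_one: "\<one>\<^bsub>fraction_field R\<^esub> = fraction R \<one> \<one>"
  by (simp_all add: fraction_field_def)

theorem field_fraction_field: "field (fraction_field R)"
proof -
  let ?F = "fraction_field R"
  note calc = fraction_mult fraction_add fraction_zero fraction_one fraction_in_carrier integral_iff
  have "cring ?F"
  proof (rule cringI)
    show "abelian_group ?F"
    proof (rule abelian_groupI)
      fix x y assume "x \<in> carrier ?F" "y \<in> carrier ?F"
      then show "x \<oplus>\<^bsub>?F\<^esub> y \<in> carrier ?F"
        by (elim fraction_carrierE) (simp add: calc)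
    next
      show "\<zero>\<^bsub>?F\<^esub> \<in> carrier ?F" by (simp add: calc)
    next
      fix x y z assume "x \<in> carrier ?F" "y \<in> carrier ?F" "z \<in> carrier ?F"
      then show "x \<oplus>\<^bsub>?F\<^esub> y \<oplus>\<^bsub>?F\<^esub> z = x \<oplus>\<^bsub>?F\<^esub> (y \<oplus>\<^bsub>?F\<^esub> z)"
        by (elim fraction_carrierE) (simp add: calc l_distr r_distr m_ac a_ac)
    next
      fix x y assume "x \<in> carrier ?F" "y \<in> carrier ?F"
      then show "x \<oplus>\<^bsub>?F\<^esub> y = y \<oplus>\<^bsub>?F\<^esub> x"
        by (elim fraction_carrierE) (simp add: calc m_ac a_ac)
    next
      fix x assume "x \<in> carrier ?F"
      then show "\<zero>\<^bsub>?F\<^esub> \<oplus>\<^bsub>?F\<^esub> x = x"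
        by (elim fraction_carrierE) (simp add: calc)
    next
      fix x assume "x \<in> carrier ?F"
      then obtain a b where ab: "a \<in> carrier R" "b \<in> carrier R" "b \<noteq> \<zero>" "x = fraction R a b"
        by (elim fraction_carrierE)
      have "fraction R (\<ominus> a) b \<oplus>\<^bsub>?F\<^esub> x = \<zero>\<^bsub>?F\<^esub>"
        using ab by (simp add: calc fraction_eq_iff l_neg l_minus)
      with ab show "\<exists>y\<in>carrier ?F. y \<oplus>\<^bsub>?F\<^esub> x = \<zero>\<^bsub>?F\<^esub>"
        by (intro bexI[of _ "fraction R (\<ominus> a) b"]) (simp_all add: calc)
    qed
  next
    show "comm_monoid ?F"
    proof (rule comm_monoidI)
      fix x y assume "x \<in> carrier ?F" "y \<in> carrier ?F"
      then show "x \<otimes>\<^bsub>?F\<^esub> y \<in> carrier ?F"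
        by (elim fraction_carrierE) (simp add: calc)
    next
      show "\<one>\<^bsub>?F\<^esub> \<in> carrier ?F" by (simp add: calc)
    next
      fix x y z assume "x \<in> carrier ?F" "y \<in> carrier ?F" "z \<in> carrier ?F"
      then show "x \<otimes>\<^bsub>?F\<^esub> y \<otimes>\<^bsub>?F\<^esub> z = x \<otimes>\<^bsub>?F\<^esub> (y \<otimes>\<^bsub>?F\<^esub> z)"
        by (elim fraction_carrierE) (simp add: calc m_ac)
    next
      fix x assume "x \<in> carrier ?F"
      then show "\<one>\<^bsub>?F\<^esub> \<otimes>\<^bsub>?F\<^esub> x = x"
        by (elim fraction_carrierE) (simp add: calc)
    next
      fix x y assume "x \<in> carrier ?F" "y \<in> carrier ?F"
      then show "x \<otimes>\<^bsub>?F\<^esub> y = y \<otimes>\<^bsub>?F\<^esub> x"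
        by (elim fraction_carrierE) (simp add: calc m_ac)
    qed
  next
    fix x y z assume "x \<in> carrier ?F" "y \<in> carrier ?F" "z \<in> carrier ?F"
    then show "(x \<oplus>\<^bsub>?F\<^esub> y) \<otimes>\<^bsub>?F\<^esub> z = x \<otimes>\<^bsub>?F\<^esub> z \<oplus>\<^bsub>?F\<^esub> y \<otimes>\<^bsub>?F\<^esub> z"
      by (elim fraction_carrierE) (simp add: calc fraction_eq_iff l_distr r_distr m_ac)
  qed
  then interpret F: cring ?F .
  show ?thesis
  proof (rule F.cring_fieldI2)
    show "\<zero>\<^bsub>?F\<^esub> \<noteq> \<one>\<^bsub>?F\<^esub>" by (simp add: calc fraction_eq_iff)
  next
    fix x assume "x \<in> carrier ?F" "x \<noteq> \<zero>\<^bsub>?F\<^esub>"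
    then obtain a b where ab: "a \<in> carrier R" "b \<in> carrier R" "b \<noteq> \<zero>" "x = fraction R a b"
      and "a \<noteq> \<zero>"
      by (elim fraction_carrierE) (auto simp: calc fraction_eq_iff)
    then show "\<exists>y\<in>carrier ?F. x \<otimes>\<^bsub>?F\<^esub> y = \<one>\<^bsub>?F\<^esub>"
      by (intro bexI[of _ "fraction R b a"]) (simp_all add: calc fraction_eq_iff m_comm)
  qed
qed

lemma to_fraction_hom: "to_fraction R \<in> ring_hom R (fraction_field R)"
  by (rule ring_hom_memI)
    (simp_all add: fraction_mult fraction_add fraction_one fraction_in_carrier)

lemma inj_on_to_fraction: "inj_on (to_fraction R) (carrier R)"
  by (rule inj_onI) (simp add: fraction_eq_iff)

end


section \<open>Egyptian domains\<close>

text \<open>The denominators form a set because they are distinct. It is nonempty because the sum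
  has at least one term; this matters for the element \<open>0\<close> only.\<close>

definition egyptian_element :: "('a, 'b) ring_scheme \<Rightarrow> ('a \<times> 'a) set \<Rightarrow> bool" where
  "egyptian_element D x \<longleftrightarrow>
     (\<exists>E. finite E \<and> E \<noteq> {} \<and> E \<subseteq> carrier D - {\<zero>\<^bsub>D\<^esub>} \<and>
        x = (\<Oplus>\<^bsub>fraction_field D\<^esub> d \<in> E. fraction D \<one>\<^bsub>D\<^esub> d))"

definition egyptian_domain :: "('a, 'b) ring_scheme \<Rightarrow> bool" where
  "egyptian_domain D \<longleftrightarrow>
     domain D \<and> (\<forall>x \<in> carrier D - {\<zero>\<^bsub>D\<^esub>}. egyptian_element D (to_fraction D x))"

text \<open>\<open>D[1/f]\<close>, as a subring of the field of fractions of \<open>D\<close>.\<close>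

definition adjoin_inverse :: "('a, 'b) ring_scheme \<Rightarrow> 'a \<Rightarrow> ('a \<times> 'a) set ring" where
  "adjoin_inverse D f =
     (fraction_field D)\<lparr>carrier :=
        generate_ring (fraction_field D) (insert (fraction D \<one>\<^bsub>D\<^esub> f) (to_fraction D ` carrier D))\<rparr>"

definition generically_egyptian_domain :: "('a, 'b) ring_scheme \<Rightarrow> bool" where
  "generically_egyptian_domain D \<longleftrightarrow>
     domain D \<and> (\<exists>f \<in> carrier D - {\<zero>\<^bsub>D\<^esub>}. egyptian_domain (adjoin_inverse D f))"

end

theory Submission
  imports Defs
begin

text \<open>
  Both claims come from rescaling unit fractions. Let \<open>a \<noteq> 0\<close> lie in the shared ideal \<open>I\<close>, so that
  \<open>aS \<subseteq> I \<subseteq> R\<close>. If \<open>r \<in> R\<close> is nonzero, then \<open>ra\<close> is a nonzero element of \<open>S\<close>; if \<open>S\<close> is Egyptian,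
  \<open>ra = 1/s\<^sub>1 + \<dots> + 1/s\<^sub>n\<close> with distinct \<open>s\<^sub>i \<in> S\<close>. Dividing by \<open>a\<close> gives
  \<open>r = 1/(a s\<^sub>1) + \<dots> + 1/(a s\<^sub>n)\<close>, and the \<open>a s\<^sub>i\<close> are distinct nonzero elements of \<open>R\<close>.

  Now let \<open>S[1/f]\<close> be Egyptian, and put \<open>g = af \<in> I\<close>. Then \<open>S[1/f] \<subseteq> R[1/g]\<close>: an element \<open>s\<close> of \<open>S\<close> is
  \<open>(gs)/g\<close> with \<open>gs \<in> I \<subseteq> R\<close>, and \<open>1/f = a/g\<close>. If \<open>y \<in> R[1/g]\<close> is nonzero, then \<open>y g\<^sup>n \<in> R\<close> for some \<open>n\<close>
  (\<open>adjoin_inverse_clear_denominator\<close>). This is an element of \<open>S[1/f]\<close>, hence a sum of distinct unit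
  fractions over \<open>S[1/f]\<close>; dividing by \<open>g\<^sup>n\<close> multiplies the denominators by \<open>g\<^sup>n\<close>, which puts them in
  \<open>R[1/g]\<close> and keeps them distinct.

  The two arguments are the same, and \<open>egyptian_domain_transfer\<close> is their common form, with a scaling
  factor \<open>u\<close> in place of \<open>a\<close> or \<open>g\<^sup>n\<close>. Whether a domain is Egyptian is decided in its own field of
  fractions, and the fields of fractions of \<open>S\<close>, \<open>R\<close>, \<open>S[1/f]\<close> and \<open>R[1/g]\<close> are different as sets of
  equivalence classes: for \<open>R[1/g]\<close>, they are classes of pairs of classes. Therefore the domains are
  compared inside one field \<open>K\<close>, here the field of fractions of \<open>S\<close>, into which they all embed. By
  \<open>egyptian_element_iff_sum_inv\<close>, the sum of unit fractions may be taken in any field into which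
  the domain embeds.
\<close>


section \<open>Fractions over a field\<close>

context field
begin

lemma inv_nonzero:
  assumes "a \<in> carrier R" "a \<noteq> \<zero>"
  shows "inv a \<in> carrier R" "inv a \<noteq> \<zero>" "a \<otimes> inv a = \<one>" "inv a \<otimes> a = \<one>"
proof -
  have "a \<in> Units R"
    using assms field_Units by auto
  then show "inv a \<in> carrier R" "a \<otimes> inv a = \<one>" "inv a \<otimes> a = \<one>"
    by simp_all
  then show "inv a \<noteq> \<zero>"
    using assms by auto
qed

lemma inv_mult_nonzero:
  assumes "a \<in> carrier R" "a \<noteq> \<zero>" "b \<in> carrier R" "b \<noteq> \<zero>"
  shows "inv (a \<otimes> b) = inv a \<otimes> inv b"
proof (rule comm_inv_char)
  have "a \<otimes> b \<otimes> (inv a \<otimes> inv b) = (a \<otimes> inv a) \<otimes> (b \<otimes> inv b)"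
    using assms inv_nonzero(1) by (simp add: m_ac)
  then show "a \<otimes> b \<otimes> (inv a \<otimes> inv b) = \<one>"
    using assms by (simp add: inv_nonzero)
qed (use assms inv_nonzero in auto)

lemma eq_divide_iff:
  assumes "a \<in> carrier R" "b \<in> carrier R" "b \<noteq> \<zero>" "x \<in> carrier R"
  shows "x = a \<otimes> inv b \<longleftrightarrow> x \<otimes> b = a"
proof
  assume "x = a \<otimes> inv b"
  then show "x \<otimes> b = a"
    using assms inv_nonzero by (simp add: m_assoc)
next
  assume "x \<otimes> b = a"
  then have "a \<otimes> inv b = x \<otimes> (b \<otimes> inv b)"
    using assms inv_nonzero(1) m_assoc[of x b "inv b"] by simp
  then show "x = a \<otimes> inv b"
    using assms inv_nonzero by simp
qed

lemma divide_add:
  assumes "a \<in> carrier R" "b \<in> carrier R" "b \<noteq> \<zero>" "c \<in> carrier R" "d \<in> carrier R" "d \<noteq> \<zero>"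
  shows "(a \<otimes> d \<oplus> c \<otimes> b) \<otimes> inv (b \<otimes> d) = a \<otimes> inv b \<oplus> c \<otimes> inv d"
proof -
  note i = inv_nonzero[OF assms(2,3)] inv_nonzero[OF assms(5,6)]
  have "(a \<otimes> d \<oplus> c \<otimes> b) \<otimes> (inv b \<otimes> inv d)
      = a \<otimes> inv b \<otimes> (d \<otimes> inv d) \<oplus> c \<otimes> inv d \<otimes> (b \<otimes> inv b)"
    using assms(1,2,4,5) i(1,5) by algebra
  then show ?thesis
    using assms i by (simp add: inv_mult_nonzero)
qed

end


section \<open>Egyptian elements inside a field containing the domain\<close>

lemma inj_hom_nonzero:
  assumes "domain D" "field K" "\<phi> \<in> ring_hom D K" "inj_on \<phi> (carrier D)"
    and "d \<in> carrier D" "d \<noteq> \<zero>\<^bsub>D\<^esub>"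
  shows "\<phi> d \<noteq> \<zero>\<^bsub>K\<^esub>"
proof
  interpret D: domain D by fact
  interpret K: field K by fact
  interpret h: ring_hom_cring D K \<phi>
    by unfold_locales fact
  assume "\<phi> d = \<zero>\<^bsub>K\<^esub>"
  then have "\<phi> d = \<phi> \<zero>\<^bsub>D\<^esub>"
    by simp
  then show False
    using inj_onD[OF assms(4) _ assms(5)] assms(6) by blast
qed

text \<open>The universal property of the field of fractions: an embedding of \<open>D\<close> into a field extends to
  \<open>a/b \<mapsto> \<phi>(a) / \<phi>(b)\<close>.\<close>

lemma fraction_field_universal:
  assumes "domain D" "field K" "\<phi> \<in> ring_hom D K" "inj_on \<phi> (carrier D)"
  obtains \<Phi> where "\<Phi> \<in> ring_hom (fraction_field D) K"
    and "\<And>a b. a \<in> carrier D \<Longrightarrow> b \<in> carrier D - {\<zero>\<^bsub>D\<^esub>} \<Longrightarrow>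
      \<Phi> (fraction D a b) = \<phi> a \<otimes>\<^bsub>K\<^esub> inv\<^bsub>K\<^esub> (\<phi> b)"
proof -
  interpret D: domain D by fact
  interpret K: field K by fact
  interpret h: ring_hom_cring D K \<phi>
    by unfold_locales fact
  note nz = inj_hom_nonzero[OF assms]
  \<comment> \<open>A fraction is a class of pairs, and the value does not depend on the pair that is chosen.\<close>
  define \<Phi> where "\<Phi> p = (case SOME q. q \<in> p of (a, b) \<Rightarrow> \<phi> a \<otimes>\<^bsub>K\<^esub> inv\<^bsub>K\<^esub> (\<phi> b))" for p
  have \<Phi>: "\<Phi> (fraction D a b) = \<phi> a \<otimes>\<^bsub>K\<^esub> inv\<^bsub>K\<^esub> (\<phi> b)"
    if ab: "a \<in> carrier D" "b \<in> carrier D - {\<zero>\<^bsub>D\<^esub>}" for a b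
  proof -
    obtain c d where cd: "(SOME q. q \<in> fraction D a b) = (c, d)"
      by fastforce
    have "(c, d) \<in> fraction D a b"
      using someI[of "\<lambda>q. q \<in> fraction D a b", OF D.fraction_self[OF ab]] cd by simp
    then have c: "c \<in> carrier D" and d: "d \<in> carrier D" "d \<noteq> \<zero>\<^bsub>D\<^esub>"
      and eq: "a \<otimes>\<^bsub>D\<^esub> d = c \<otimes>\<^bsub>D\<^esub> b"
      by (auto simp: fraction_def)
    have "\<phi> a \<otimes>\<^bsub>K\<^esub> \<phi> d = \<phi> c \<otimes>\<^bsub>K\<^esub> \<phi> b"
      using arg_cong[OF eq, of \<phi>] ab c d by simp
    then have "\<phi> c \<otimes>\<^bsub>K\<^esub> inv\<^bsub>K\<^esub> (\<phi> d) \<otimes>\<^bsub>K\<^esub> \<phi> b = \<phi> a \<otimes>\<^bsub>K\<^esub> (inv\<^bsub>K\<^esub> (\<phi> d) \<otimes>\<^bsub>K\<^esub> \<phi> d)"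
      using ab c d nz K.inv_nonzero(1) by (metis DiffD1 K.m_assoc K.m_comm h.hom_closed)
    then have "\<phi> c \<otimes>\<^bsub>K\<^esub> inv\<^bsub>K\<^esub> (\<phi> d) = \<phi> a \<otimes>\<^bsub>K\<^esub> inv\<^bsub>K\<^esub> (\<phi> b)"
      using ab c d nz K.inv_nonzero by (subst K.eq_divide_iff) auto
    then show ?thesis
      by (simp add: \<Phi>_def cd)
  qed
  have "\<Phi> \<in> ring_hom (fraction_field D) K"
  proof (rule ring_hom_memI)
    fix x assume "x \<in> carrier (fraction_field D)"
    then show "\<Phi> x \<in> carrier K"
      by (elim D.fraction_carrierE) (use K.inv_nonzero(1) nz in \<open>auto simp: \<Phi>\<close>)
  next
    fix x y assume "x \<in> carrier (fraction_field D)" "y \<in> carrier (fraction_field D)"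
    then obtain a b c d where x: "a \<in> carrier D" "b \<in> carrier D" "b \<noteq> \<zero>\<^bsub>D\<^esub>" "x = fraction D a b"
      and y: "c \<in> carrier D" "d \<in> carrier D" "d \<noteq> \<zero>\<^bsub>D\<^esub>" "y = fraction D c d"
      by (metis D.fraction_carrierE)
    note cl = x(1,2) y(1,2) nz[OF x(2,3)] nz[OF y(2,3)]
    have i: "inv\<^bsub>K\<^esub> (\<phi> b) \<in> carrier K" "inv\<^bsub>K\<^esub> (\<phi> d) \<in> carrier K"
      "\<phi> b \<otimes>\<^bsub>K\<^esub> inv\<^bsub>K\<^esub> (\<phi> b) = \<one>\<^bsub>K\<^esub>" "\<phi> d \<otimes>\<^bsub>K\<^esub> inv\<^bsub>K\<^esub> (\<phi> d) = \<one>\<^bsub>K\<^esub>"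
      using K.inv_nonzero cl by simp_all
    show "\<Phi> (x \<otimes>\<^bsub>fraction_field D\<^esub> y) = \<Phi> x \<otimes>\<^bsub>K\<^esub> \<Phi> y"
      using x y cl i by (simp add: D.fraction_mult \<Phi> D.integral_iff K.inv_mult_nonzero K.m_ac)
    show "\<Phi> (x \<oplus>\<^bsub>fraction_field D\<^esub> y) = \<Phi> x \<oplus>\<^bsub>K\<^esub> \<Phi> y"
      using x y cl i by (simp add: D.fraction_add \<Phi> D.integral_iff K.divide_add)
  next
    show "\<Phi> \<one>\<^bsub>fraction_field D\<^esub> = \<one>\<^bsub>K\<^esub>"
      using K.inv_nonzero by (simp add: D.fraction_one \<Phi>)
  qed
  with \<Phi> show thesis
    using that by blast
qed

text \<open>The extension of \<open>\<phi>\<close> to the field of fractions is a homomorphism of fields, hence injective: it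
  maps a sum of unit fractions to the sum of the inverses in \<open>K\<close>, and loses no information. The
  lemma frees all later computations from equivalence classes.\<close>

lemma egyptian_element_iff_sum_inv:
  assumes "domain D" "field K" "\<phi> \<in> ring_hom D K" "inj_on \<phi> (carrier D)"
    and x: "x \<in> carrier D"
  shows "egyptian_element D (to_fraction D x) \<longleftrightarrow>
    (\<exists>E. finite E \<and> E \<noteq> {} \<and> E \<subseteq> carrier D - {\<zero>\<^bsub>D\<^esub>} \<and>
      \<phi> x = (\<Oplus>\<^bsub>K\<^esub> d \<in> E. inv\<^bsub>K\<^esub> (\<phi> d)))"
proof -
  interpret D: domain D by fact
  interpret K: field K by fact
  interpret h: ring_hom_cring D K \<phi>
    by unfold_locales fact
  interpret F: field "fraction_field D"
    by (rule D.field_fraction_field)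
  obtain \<Phi> where hom: "\<Phi> \<in> ring_hom (fraction_field D) K"
    and \<Phi>: "\<And>a b. a \<in> carrier D \<Longrightarrow> b \<in> carrier D - {\<zero>\<^bsub>D\<^esub>} \<Longrightarrow>
      \<Phi> (fraction D a b) = \<phi> a \<otimes>\<^bsub>K\<^esub> inv\<^bsub>K\<^esub> (\<phi> b)"
    using fraction_field_universal[OF assms(1-4)] by blast
  interpret H: ring_hom_cring "fraction_field D" K \<Phi>
    by unfold_locales fact
  have inj: "inj_on \<Phi> (carrier (fraction_field D))"
    using non_trivial_field_hom_is_inj[OF hom F.field_axioms K.field_axioms] .
  note nz = inj_hom_nonzero[OF assms(1-4)]
  have "to_fraction D x = (\<Oplus>\<^bsub>fraction_field D\<^esub> d \<in> E. fraction D \<one>\<^bsub>D\<^esub> d) \<longleftrightarrow>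
      \<phi> x = (\<Oplus>\<^bsub>K\<^esub> d \<in> E. inv\<^bsub>K\<^esub> (\<phi> d))"
    if E: "E \<subseteq> carrier D - {\<zero>\<^bsub>D\<^esub>}" for E
  proof -
    let ?s = "\<Oplus>\<^bsub>fraction_field D\<^esub> d \<in> E. fraction D \<one>\<^bsub>D\<^esub> d"
    have cl: "(\<lambda>d. fraction D \<one>\<^bsub>D\<^esub> d) \<in> E \<rightarrow> carrier (fraction_field D)"
      using E by (auto intro!: D.fraction_in_carrier)
    have "\<Phi> ?s = (\<Oplus>\<^bsub>K\<^esub> d \<in> E. inv\<^bsub>K\<^esub> (\<phi> d))"
      unfolding H.hom_finsum[OF cl]
      by (rule K.finsum_cong') (use E nz K.inv_nonzero(1) \<Phi> in \<open>auto simp: subset_eq\<close>)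
    moreover have "\<Phi> (to_fraction D x) = \<phi> x"
      using x K.inv_nonzero by (simp add: \<Phi> K.eq_divide_iff[symmetric])
    moreover have "to_fraction D x = ?s \<longleftrightarrow> \<Phi> (to_fraction D x) = \<Phi> ?s"
      using x F.finsum_closed[OF cl] by (simp add: inj_on_eq_iff[OF inj] D.fraction_in_carrier)
    ultimately show ?thesis
      by simp
  qed
  then show ?thesis
    unfolding egyptian_element_def by blast
qed

text \<open>Scaling by \<open>u\<close> carries \<open>y\<close> into \<open>D\<close>, where it is a sum of inverses of distinct elements \<open>d\<close>.
  Division by \<open>u\<close> turns each \<open>1/d\<close> into \<open>1/(ud)\<close>, so the same factor \<open>u\<close> carries the denominators
  into \<open>D'\<close>. The factor may depend on \<open>y\<close>, as it must when \<open>y\<close> has a denominator to be cleared.\<close>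

lemma egyptian_domain_transfer:
  assumes D: "egyptian_domain D" and D': "domain D'" and K: "field K"
    and \<phi>: "\<phi> \<in> ring_hom D K" "inj_on \<phi> (carrier D)"
    and \<psi>: "\<psi> \<in> ring_hom D' K" "inj_on \<psi> (carrier D')"
    and scale: "\<And>y. y \<in> carrier D' \<Longrightarrow> y \<noteq> \<zero>\<^bsub>D'\<^esub> \<Longrightarrow>
      \<exists>u \<in> carrier K - {\<zero>\<^bsub>K\<^esub>}. \<psi> y \<otimes>\<^bsub>K\<^esub> u \<in> \<phi> ` carrier D \<and>
        (\<forall>d \<in> carrier D. u \<otimes>\<^bsub>K\<^esub> \<phi> d \<in> \<psi> ` carrier D')"
  shows "egyptian_domain D'"
  unfolding egyptian_domain_def
proof (intro conjI ballI)
  have "domain D"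
    using D by (simp add: egyptian_domain_def)
  interpret D: domain D by fact
  interpret D': domain D' by fact
  interpret K: field K by fact
  interpret h: ring_hom_cring D K \<phi>
    by unfold_locales fact
  interpret h': ring_hom_cring D' K \<psi>
    by unfold_locales fact
  note nz = inj_hom_nonzero[OF \<open>domain D\<close> K \<phi>]
  fix y assume "y \<in> carrier D' - {\<zero>\<^bsub>D'\<^esub>}"
  then have y: "y \<in> carrier D'" "y \<noteq> \<zero>\<^bsub>D'\<^esub>"
    by simp_all
  obtain u x where u: "u \<in> carrier K" "u \<noteq> \<zero>\<^bsub>K\<^esub>"
    and x: "x \<in> carrier D" "\<psi> y \<otimes>\<^bsub>K\<^esub> u = \<phi> x"
    and pull: "\<forall>d \<in> carrier D. u \<otimes>\<^bsub>K\<^esub> \<phi> d \<in> \<psi> ` carrier D'"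
    using scale[OF y] by blast
  have "\<phi> x \<noteq> \<zero>\<^bsub>K\<^esub>"
    using u y inj_hom_nonzero[OF D' K \<psi> y] by (simp add: x(2)[symmetric] K.integral_iff)
  then have "x \<noteq> \<zero>\<^bsub>D\<^esub>"
    by auto
  then have "egyptian_element D (to_fraction D x)"
    using D x(1) by (simp add: egyptian_domain_def)
  then obtain E where E: "finite E" "E \<noteq> {}" "E \<subseteq> carrier D - {\<zero>\<^bsub>D\<^esub>}"
    and sum: "\<phi> x = (\<Oplus>\<^bsub>K\<^esub> d \<in> E. inv\<^bsub>K\<^esub> (\<phi> d))"
    unfolding egyptian_element_iff_sum_inv[OF \<open>domain D\<close> K \<phi> x(1)] by blast
  \<comment> \<open>\<open>s d\<close> is the new denominator \<open>ud\<close>, as an element of \<open>D'\<close>.\<close>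
  have "\<forall>d \<in> carrier D. \<exists>e. e \<in> carrier D' \<and> \<psi> e = u \<otimes>\<^bsub>K\<^esub> \<phi> d"
    using pull by (metis image_iff)
  then obtain s where "\<forall>d \<in> carrier D. s d \<in> carrier D' \<and> \<psi> (s d) = u \<otimes>\<^bsub>K\<^esub> \<phi> d"
    by (rule bchoice[THEN exE])
  then have s: "s d \<in> carrier D'" "\<psi> (s d) = u \<otimes>\<^bsub>K\<^esub> \<phi> d" if "d \<in> carrier D" for d
    using that by simp_all
  have Ecl: "d \<in> carrier D" "\<phi> d \<in> carrier K" "\<phi> d \<noteq> \<zero>\<^bsub>K\<^esub>" "inv\<^bsub>K\<^esub> (\<phi> d) \<in> carrier K"
    if "d \<in> E" for d
    using that E(3) nz K.inv_nonzero(1) by (auto simp: subset_eq)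
  have s_nz: "s d \<noteq> \<zero>\<^bsub>D'\<^esub>" if "d \<in> E" for d
  proof
    assume "s d = \<zero>\<^bsub>D'\<^esub>"
    then have "u \<otimes>\<^bsub>K\<^esub> \<phi> d = \<zero>\<^bsub>K\<^esub>"
      using s(2)[OF Ecl(1)[OF that]] by simp
    then show False
      using u Ecl[OF that] by (simp add: K.integral_iff)
  qed
  have s_cl: "\<psi> (s d) \<in> carrier K" "\<psi> (s d) \<noteq> \<zero>\<^bsub>K\<^esub>" if "d \<in> E" for d
    using s(1)[OF Ecl(1)[OF that]] s_nz[OF that] inj_hom_nonzero[OF D' K \<psi>] by auto
  have inj: "inj_on s E"
  proof (rule inj_onI)
    fix d e assume de: "d \<in> E" "e \<in> E" "s d = s e"
    then have "u \<otimes>\<^bsub>K\<^esub> \<phi> d = u \<otimes>\<^bsub>K\<^esub> \<phi> e"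
      using s(2) Ecl(1) by metis
    then have "\<phi> d = \<phi> e"
      using u Ecl(2) de by (simp add: K.m_lcancel)
    then show "d = e"
      using \<phi>(2) de Ecl(1) by (auto dest: inj_onD)
  qed
  have "\<psi> y = \<phi> x \<otimes>\<^bsub>K\<^esub> inv\<^bsub>K\<^esub> u"
    using u y x by (subst K.eq_divide_iff) simp_all
  also have "\<dots> = (\<Oplus>\<^bsub>K\<^esub> d \<in> E. inv\<^bsub>K\<^esub> (\<phi> d) \<otimes>\<^bsub>K\<^esub> inv\<^bsub>K\<^esub> u)"
    unfolding sum by (rule K.finsum_ldistr) (use E(1) u K.inv_nonzero Ecl in auto)
  also have "\<dots> = (\<Oplus>\<^bsub>K\<^esub> d \<in> E. inv\<^bsub>K\<^esub> (\<psi> (s d)))"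
  proof (rule K.finsum_cong')
    fix d assume "d \<in> E"
    then show "inv\<^bsub>K\<^esub> (\<phi> d) \<otimes>\<^bsub>K\<^esub> inv\<^bsub>K\<^esub> u = inv\<^bsub>K\<^esub> (\<psi> (s d))"
      using u Ecl[of d] s(2)[of d] K.inv_nonzero(1)[of u] by (simp add: K.inv_mult_nonzero K.m_comm)
  next
    show "(\<lambda>d. inv\<^bsub>K\<^esub> (\<psi> (s d))) \<in> E \<rightarrow> carrier K"
      using s_cl K.inv_nonzero(1) by auto
  qed simp
  also have "\<dots> = (\<Oplus>\<^bsub>K\<^esub> e \<in> s ` E. inv\<^bsub>K\<^esub> (\<psi> e))"
    by (rule K.finsum_reindex[symmetric, OF _ inj]) (use s_cl K.inv_nonzero(1) in blast)
  finally have "\<psi> y = (\<Oplus>\<^bsub>K\<^esub> e \<in> s ` E. inv\<^bsub>K\<^esub> (\<psi> e))" .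
  moreover have "finite (s ` E)" "s ` E \<noteq> {}" "s ` E \<subseteq> carrier D' - {\<zero>\<^bsub>D'\<^esub>}"
    using E(1,2) s(1)[OF Ecl(1)] s_nz by (simp_all add: image_subset_iff)
  ultimately show "egyptian_element D' (to_fraction D' y)"
    unfolding egyptian_element_iff_sum_inv[OF D' K \<psi> y(1)]
    by (intro exI[of _ "s ` E"] conjI)
qed (rule D')


section \<open>The ring obtained by inverting one element\<close>

context domain
begin

lemma nat_pow_nonzero:
  assumes "f \<in> carrier R - {\<zero>}"
  shows "f [^] (n::nat) \<in> carrier R - {\<zero>}"
  using assms by (induction n) (auto simp: integral_iff)

lemma adjoin_inverse_subring:
  assumes "f \<in> carrier R - {\<zero>}"
  shows "subring (carrier (adjoin_inverse R f)) (fraction_field R)"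
    and "insert (fraction R \<one> f) (to_fraction R ` carrier R) \<subseteq> carrier (adjoin_inverse R f)"
    and "\<And>T. subring T (fraction_field R) \<Longrightarrow>
      insert (fraction R \<one> f) (to_fraction R ` carrier R) \<subseteq> T \<Longrightarrow> carrier (adjoin_inverse R f) \<subseteq> T"
proof -
  interpret F: field "fraction_field R"
    by (rule field_fraction_field)
  have "insert (fraction R \<one> f) (to_fraction R ` carrier R) \<subseteq> carrier (fraction_field R)"
    using assms by (auto intro!: fraction_in_carrier)
  note gen = F.generate_ringE[OF this refl]
  show "subring (carrier (adjoin_inverse R f)) (fraction_field R)"
    "insert (fraction R \<one> f) (to_fraction R ` carrier R) \<subseteq> carrier (adjoin_inverse R f)"
    using gen(1,2) by (simp_all add: adjoin_inverse_def)
  show "carrier (adjoin_inverse R f) \<subseteq> T" if "subring T (fraction_field R)"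
    "insert (fraction R \<one> f) (to_fraction R ` carrier R) \<subseteq> T" for T
    using gen(3)[OF that] by (simp add: adjoin_inverse_def)
qed

lemma adjoin_inverse_eq:
  "adjoin_inverse R f = (fraction_field R)\<lparr>carrier := carrier (adjoin_inverse R f)\<rparr>"
  by (simp add: adjoin_inverse_def)

lemma domain_adjoin_inverse:
  assumes "f \<in> carrier R - {\<zero>}"
  shows "domain (adjoin_inverse R f)"
proof -
  interpret F: field "fraction_field R"
    by (rule field_fraction_field)
  show ?thesis
    by (subst adjoin_inverse_eq) (rule F.subring_is_domain[OF adjoin_inverse_subring(1)[OF assms]])
qed

text \<open>The fractions \<open>a/f\<^sup>n\<close> form a subring that contains the generators of \<open>D[1/f]\<close>.\<close>

lemma adjoin_inverse_clear_denominator: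
  assumes f: "f \<in> carrier R - {\<zero>}" and x: "x \<in> carrier (adjoin_inverse R f)"
  shows "\<exists>n::nat. \<exists>a \<in> carrier R. x \<otimes>\<^bsub>fraction_field R\<^esub> to_fraction R (f [^] n) = to_fraction R a"
proof -
  interpret F: field "fraction_field R"
    by (rule field_fraction_field)
  define T where "T = {fraction R a (f [^] n) | a n. a \<in> carrier R \<and> n \<in> (UNIV :: nat set)}"
  note pow = nat_pow_nonzero[OF f]
  have pow': "f [^] n \<in> carrier R" "f [^] n \<noteq> \<zero>" for n :: nat
    using pow[of n] by auto
  have "subring T (fraction_field R)"
  proof (rule F.subringI)
    show "T \<subseteq> carrier (fraction_field R)"
      using pow' by (auto simp: T_def intro!: fraction_in_carrier)
    have "\<one>\<^bsub>fraction_field R\<^esub> = fraction R \<one> (f [^] (0::nat))"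
      by (simp add: fraction_one)
    then show "\<one>\<^bsub>fraction_field R\<^esub> \<in> T"
      unfolding T_def by blast
  next
    fix h assume "h \<in> T"
    then obtain a and n :: nat where a: "a \<in> carrier R" and h: "h = fraction R a (f [^] n)"
      by (auto simp: T_def)
    have "fraction R (\<ominus> a) (f [^] n) \<oplus>\<^bsub>fraction_field R\<^esub> h = \<zero>\<^bsub>fraction_field R\<^esub>"
      using a pow' by (simp add: h fraction_add fraction_zero fraction_eq_iff integral_iff l_minus l_neg)
    then have "\<ominus>\<^bsub>fraction_field R\<^esub> h = fraction R (\<ominus> a) (f [^] n)"
      using a pow' by (intro F.minus_equality) (simp_all add: h fraction_in_carrier)
    then show "\<ominus>\<^bsub>fraction_field R\<^esub> h \<in> T"
      using a by (auto simp: T_def)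
  next
    fix h k assume "h \<in> T" "k \<in> T"
    then obtain a b and n m :: nat where a: "a \<in> carrier R" and h: "h = fraction R a (f [^] n)"
      and b: "b \<in> carrier R" and k: "k = fraction R b (f [^] m)"
      by (auto simp: T_def)
    have nm: "f [^] n \<otimes> f [^] m = f [^] (n + m)"
      using f by (simp add: nat_pow_mult)
    have "h \<otimes>\<^bsub>fraction_field R\<^esub> k = fraction R (a \<otimes> b) (f [^] (n + m))"
      using a b pow by (simp add: h k fraction_mult nm)
    then show "h \<otimes>\<^bsub>fraction_field R\<^esub> k \<in> T"
      using a b unfolding T_def by blast
    have "h \<oplus>\<^bsub>fraction_field R\<^esub> k = fraction R (a \<otimes> f [^] m \<oplus> b \<otimes> f [^] n) (f [^] (n + m))"
      using a b pow by (simp add: h k fraction_add nm)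
    moreover have "a \<otimes> f [^] m \<oplus> b \<otimes> f [^] n \<in> carrier R"
      using a b pow' by simp
    ultimately show "h \<oplus>\<^bsub>fraction_field R\<^esub> k \<in> T"
      unfolding T_def by blast
  qed
  moreover have "insert (fraction R \<one> f) (to_fraction R ` carrier R) \<subseteq> T"
  proof -
    have "fraction R \<one> f = fraction R \<one> (f [^] (1::nat))"
      using f by simp
    moreover have "to_fraction R a = fraction R a (f [^] (0::nat))" for a
      by simp
    ultimately show ?thesis
      unfolding T_def by blast
  qed
  ultimately have "x \<in> T"
    using adjoin_inverse_subring(3)[OF f] x by blast
  then obtain a and n :: nat where a: "a \<in> carrier R" and x: "x = fraction R a (f [^] n)"
    by (auto simp: T_def)
  have "x \<otimes>\<^bsub>fraction_field R\<^esub> to_fraction R (f [^] n) = to_fraction R a"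
    using a pow' by (simp add: x fraction_mult fraction_eq_iff)
  with a show ?thesis
    by blast
qed

end


section \<open>Shared ideals\<close>

theorem theorem4p2:
  fixes S :: "('a, 'b) ring_scheme" and R I :: "'a set"
  assumes "domain S"
    and "subring R S"
    and "ideal I S"
    and "ideal I (S\<lparr>carrier := R\<rparr>)"
    and "I \<noteq> {\<zero>\<^bsub>S\<^esub>}"
  shows "(egyptian_domain S \<longrightarrow> egyptian_domain (S\<lparr>carrier := R\<rparr>)) \<and>
    (generically_egyptian_domain S \<longrightarrow> generically_egyptian_domain (S\<lparr>carrier := R\<rparr>))"
proof (intro conjI impI)
  let ?R = "S\<lparr>carrier := R\<rparr>"
  interpret S: domain S by fact
  interpret I: ideal I S by fact
  interpret R: domain ?R
    by (rule S.subring_is_domain) fact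
  have RS: "R \<subseteq> carrier S"
    using subringE(1)[OF assms(2)] .
  have IR: "I \<subseteq> R"
    using ideal.Icarr[OF assms(4)] by auto
  obtain a where a: "a \<in> I" "a \<noteq> \<zero>\<^bsub>S\<^esub>"
    using assms(5) I.zero_closed by blast
  have aS: "a \<in> carrier S"
    using a I.Icarr by blast
  define K where "K = fraction_field S"
  interpret K: field K
    unfolding K_def by (rule S.field_fraction_field)
  let ?\<iota> = "to_fraction S"
  have \<iota>: "?\<iota> \<in> ring_hom S K" "inj_on ?\<iota> (carrier S)"
    unfolding K_def by (rule S.to_fraction_hom S.inj_on_to_fraction)+
  interpret \<iota>: ring_hom_cring S K ?\<iota>
    by unfold_locales (rule \<iota>)
  have \<iota>R: "?\<iota> \<in> ring_hom ?R K" "inj_on ?\<iota> (carrier ?R)"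
  proof -
    show "?\<iota> \<in> ring_hom ?R K"
      by (rule ring_hom_memI) (use RS in \<open>simp_all add: subset_eq\<close>)
    show "inj_on ?\<iota> (carrier ?R)"
      using inj_on_subset[OF \<iota>(2) RS] by simp
  qed
  note \<iota>_nz = inj_hom_nonzero[OF S.domain_axioms K.field_axioms \<iota>]
  have aS_R: "a \<otimes>\<^bsub>S\<^esub> d \<in> R" if "d \<in> carrier S" for d
    using I.I_r_closed[OF a(1) that] IR by blast
  {
    assume "egyptian_domain S"
    then show "egyptian_domain ?R"
    proof (rule egyptian_domain_transfer[OF _ R.domain_axioms K.field_axioms \<iota> \<iota>R])
      fix y assume "y \<in> carrier ?R"
      then have y: "y \<in> carrier S"
        using RS by auto
      show "\<exists>u \<in> carrier K - {\<zero>\<^bsub>K\<^esub>}. ?\<iota> y \<otimes>\<^bsub>K\<^esub> u \<in> ?\<iota> ` carrier S \<and>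
          (\<forall>d \<in> carrier S. u \<otimes>\<^bsub>K\<^esub> ?\<iota> d \<in> ?\<iota> ` carrier ?R)"
      proof (intro bexI[of _ "?\<iota> a"] conjI ballI)
        show "?\<iota> y \<otimes>\<^bsub>K\<^esub> ?\<iota> a \<in> ?\<iota> ` carrier S"
          using y aS by (simp add: \<iota>.hom_mult[symmetric] del: \<iota>.hom_mult)
        show "?\<iota> a \<otimes>\<^bsub>K\<^esub> ?\<iota> d \<in> ?\<iota> ` carrier ?R" if "d \<in> carrier S" for d
          using that aS aS_R by (simp add: \<iota>.hom_mult[symmetric] del: \<iota>.hom_mult)
        show "?\<iota> a \<in> carrier K - {\<zero>\<^bsub>K\<^esub>}"
          using aS a(2) \<iota>_nz by simp
      qed
    qed
  }
  assume "generically_egyptian_domain S"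
  then obtain f where f: "f \<in> carrier S" "f \<noteq> \<zero>\<^bsub>S\<^esub>"
    and egypt: "egyptian_domain (adjoin_inverse S f)"
    unfolding generically_egyptian_domain_def by blast
  define g where "g = a \<otimes>\<^bsub>S\<^esub> f"
  have gI: "g \<in> I" and g_nz: "g \<noteq> \<zero>\<^bsub>S\<^esub>"
    using a aS f by (simp_all add: g_def I.I_r_closed S.integral_iff)
  then have g: "g \<in> carrier ?R - {\<zero>\<^bsub>?R\<^esub>}" and gS: "g \<in> carrier S"
    using IR I.Icarr by auto
  let ?A = "adjoin_inverse S f" and ?B = "adjoin_inverse ?R g"
  have fS: "f \<in> carrier S - {\<zero>\<^bsub>S\<^esub>}"
    using f by simp
  note A = S.adjoin_inverse_subring[OF fS, folded K_def]
  note B = R.adjoin_inverse_subring[OF g]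
  interpret FR: field "fraction_field ?R"
    by (rule R.field_fraction_field)
  \<comment> \<open>\<open>R[1/g]\<close> is built from fractions over \<open>R\<close>; \<open>\<Psi>\<close> views it inside \<open>K\<close>.\<close>
  obtain \<Psi> where hom: "\<Psi> \<in> ring_hom (fraction_field ?R) K"
    and \<Psi>: "\<And>b c. b \<in> carrier ?R \<Longrightarrow> c \<in> carrier ?R - {\<zero>\<^bsub>?R\<^esub>} \<Longrightarrow>
      \<Psi> (fraction ?R b c) = ?\<iota> b \<otimes>\<^bsub>K\<^esub> inv\<^bsub>K\<^esub> (?\<iota> c)"
    using fraction_field_universal[OF R.domain_axioms K.field_axioms \<iota>R] by blast
  interpret \<Psi>: ring_hom_cring "fraction_field ?R" K \<Psi>
    by unfold_locales (rule hom)
  have inj: "inj_on \<Psi> (carrier (fraction_field ?R))"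
    using non_trivial_field_hom_is_inj[OF hom FR.field_axioms K.field_axioms] .
  have \<Psi>_R: "\<Psi> (to_fraction ?R r) = ?\<iota> r" if "r \<in> R" for r
  proof -
    have "\<Psi> (to_fraction ?R r) = ?\<iota> r \<otimes>\<^bsub>K\<^esub> inv\<^bsub>K\<^esub> (?\<iota> \<one>\<^bsub>S\<^esub>)"
      using \<Psi>[of r "\<one>\<^bsub>?R\<^esub>"] that R.one_closed R.one_not_zero by simp
    then show ?thesis
      using that RS by (auto simp: subset_eq)
  qed
  have img: "subring (\<Psi> ` carrier ?B) K"
    by (rule \<Psi>.ring.img_is_subring[OF B(1)])
  have R_img: "?\<iota> r \<in> \<Psi> ` carrier ?B" if "r \<in> R" for r
    using B(2) that \<Psi>_R[OF that] by (auto intro!: rev_image_eqI[of "to_fraction ?R r"])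
  have invg_img: "inv\<^bsub>K\<^esub> (?\<iota> g) \<in> \<Psi> ` carrier ?B"
  proof -
    have "\<Psi> (fraction ?R \<one>\<^bsub>?R\<^esub> g) = inv\<^bsub>K\<^esub> (?\<iota> g)"
      using \<Psi>[OF R.one_closed g] K.inv_nonzero(1)[OF \<iota>.hom_closed \<iota>_nz] gS g_nz by simp
    then show ?thesis
      using B(2) by (auto intro!: rev_image_eqI[of "fraction ?R \<one>\<^bsub>?R\<^esub> g"])
  qed
  have \<iota>g: "?\<iota> g \<in> carrier K" "?\<iota> g \<noteq> \<zero>\<^bsub>K\<^esub>"
    using gS g_nz \<iota>_nz by simp_all
  have quot_img: "?\<iota> r \<otimes>\<^bsub>K\<^esub> inv\<^bsub>K\<^esub> (?\<iota> g) \<in> \<Psi> ` carrier ?B" if "r \<in> R" for r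
    using subringE(6)[OF img R_img[OF that] invg_img] .
  \<comment> \<open>The inclusion of \<open>S[1/f]\<close> in \<open>R[1/g]\<close>: every generator is an element of \<open>I\<close>
    divided by \<open>g\<close>.\<close>
  have A_img: "carrier ?A \<subseteq> \<Psi> ` carrier ?B"
  proof (rule A(3)[OF img])
    have "fraction S \<one>\<^bsub>S\<^esub> f \<otimes>\<^bsub>K\<^esub> ?\<iota> g = ?\<iota> a"
      unfolding K_def using f gS aS
      by (subst S.fraction_mult) (simp_all add: S.fraction_eq_iff g_def)
    then have "fraction S \<one>\<^bsub>S\<^esub> f = ?\<iota> a \<otimes>\<^bsub>K\<^esub> inv\<^bsub>K\<^esub> (?\<iota> g)"
      using \<iota>g aS S.fraction_in_carrier[OF S.one_closed fS, folded K_def]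
      by (subst K.eq_divide_iff) simp_all
    then have "fraction S \<one>\<^bsub>S\<^esub> f \<in> \<Psi> ` carrier ?B"
      using quot_img a IR by auto
    moreover have "?\<iota> s \<in> \<Psi> ` carrier ?B" if s: "s \<in> carrier S" for s
    proof -
      have "?\<iota> s = ?\<iota> (g \<otimes>\<^bsub>S\<^esub> s) \<otimes>\<^bsub>K\<^esub> inv\<^bsub>K\<^esub> (?\<iota> g)"
        using \<iota>g gS s by (subst K.eq_divide_iff) (simp_all add: K.m_comm)
      moreover have "g \<otimes>\<^bsub>S\<^esub> s \<in> R"
        using I.I_r_closed[OF gI s] IR by blast
      ultimately show ?thesis
        using quot_img[of "g \<otimes>\<^bsub>S\<^esub> s"] by metis
    qed
    ultimately show "insert (fraction S \<one>\<^bsub>S\<^esub> f) (?\<iota> ` carrier S) \<subseteq> \<Psi> ` carrier ?B"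
      by blast
  qed
  have "egyptian_domain ?B"
  proof (rule egyptian_domain_transfer[OF egypt R.domain_adjoin_inverse[OF g] K.field_axioms])
    show "id \<in> ring_hom ?A K"
      using subringE(1)[OF A(1)]
      by (subst S.adjoin_inverse_eq) (auto simp: ring_hom_def K_def)
    show "\<Psi> \<in> ring_hom ?B K"
      using hom subringE(1)[OF B(1)]
      by (subst R.adjoin_inverse_eq) (auto simp: ring_hom_def subset_eq)
    show "inj_on \<Psi> (carrier ?B)"
      using inj subringE(1)[OF B(1)] by (rule inj_on_subset)
    fix y assume y: "y \<in> carrier ?B"
    obtain n :: nat and r where r: "r \<in> R"
      and eq: "y \<otimes>\<^bsub>fraction_field ?R\<^esub> to_fraction ?R (g [^]\<^bsub>?R\<^esub> n) = to_fraction ?R r"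
      using R.adjoin_inverse_clear_denominator[OF g y] by auto
    let ?u = "?\<iota> (g [^]\<^bsub>?R\<^esub> n)"
    have p: "g [^]\<^bsub>?R\<^esub> n \<in> R" "g [^]\<^bsub>?R\<^esub> n \<noteq> \<zero>\<^bsub>S\<^esub>"
      using R.nat_pow_nonzero[OF g, of n] by simp_all
    show "\<exists>u \<in> carrier K - {\<zero>\<^bsub>K\<^esub>}. \<Psi> y \<otimes>\<^bsub>K\<^esub> u \<in> id ` carrier ?A \<and>
        (\<forall>d \<in> carrier ?A. u \<otimes>\<^bsub>K\<^esub> id d \<in> \<Psi> ` carrier ?B)"
    proof (intro bexI[of _ ?u] conjI ballI)
      have "\<Psi> y \<otimes>\<^bsub>K\<^esub> \<Psi> (to_fraction ?R (g [^]\<^bsub>?R\<^esub> n)) = \<Psi> (to_fraction ?R r)"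
        using arg_cong[OF eq, of \<Psi>] y subringE(1)[OF B(1)] p(1) subringE(3)[OF assms(2)]
        by (subst (asm) \<Psi>.hom_mult) (auto intro!: R.fraction_in_carrier)
      then have "\<Psi> y \<otimes>\<^bsub>K\<^esub> ?u = ?\<iota> r"
        using \<Psi>_R[OF p(1)] \<Psi>_R[OF r] by simp
      then show "\<Psi> y \<otimes>\<^bsub>K\<^esub> ?u \<in> id ` carrier ?A"
        using A(2) r RS by auto
      show "?u \<otimes>\<^bsub>K\<^esub> id d \<in> \<Psi> ` carrier ?B" if "d \<in> carrier ?A" for d
        using subringE(6)[OF img R_img[OF p(1)]] A_img that by auto
      show "?u \<in> carrier K - {\<zero>\<^bsub>K\<^esub>}"
        using p RS \<iota>_nz by auto
    qed
  qed simp
  then show "generically_egyptian_domain ?R"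
    unfolding generically_egyptian_domain_def using R.domain_axioms g by blast
qed

end
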